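(* Let $G=(\mathcal V,\mathcal E)$ be an acyclic network with a single source $S$ and a set of destinations $\mathcal T=\{T_1,\dots,T_{|\mathcal T|}\}$, and let $A$, $B$ and $F$ be its encoding, decoding and adjacency matrices. Then the system matrix $M$, i.e. the matrix satisfying $\mathcal Z=\mathcal X(S)\cdot M$, where $\mathcal Z=[\mathcal Z(T_1),\dots,\mathcal Z(T_{|\mathcal T|})]$, is given by $$M=A\,(I-F)^{-1}B^{T}.$$
   Context: Network. $G=(\mathcal V,\mathcal E)$ consists of a finite set $\mathcal V$ of nodes; each node $V$ has a finite set $I(V)$ of input ports and a finite set $O(V)$ of output ports (all these sets are pairwise disjoint). Each edge in $\mathcal E$ is an ordered pair $(e_1,e_2)$ with $e_1\in O(V_1)$ and $e_2\in I(V_2)$ for some $V_1,V_2\in\mathcal V$. $G$ is acyclic if the directed graph on $\mathcal V$ with an arc $V_1\to V_2$ whenever some edge goes from $O(V_1)$ to $I(V_2)$ has no directed cycle. Let $e_1,e_2,\dots$ enumerate all ports, and let $\mathbb F_q$ be a finite field. Linear transmission. The source $S$ has a row vector of processes (symbols in $\mathbb F_q$) $\mathcal X(S)=[X(S,1),\dots,X(S,\mu(S))]$. $Y(e)\in\mathbb F_q$ denotes the process at port $e$. For $e\in O(V)$, $V\neq S$: $Y(e)=\sum_{e'\in I(V)}\beta_{(e',e)}Y(e')$. For $e\in O(S)$: $Y(e)=\sum_{e'\in I(S)}\beta_{(e',e)}Y(e')+\sum_i\alpha_{(i,e)}X(S,i)$. For an input port $e'$: $Y(e')=\sum_{(e,e')\in\mathcal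 E}Y(e)$ (all edges leaving an output port carry the same symbol; symbols arriving at an input port are added). Each destination $T_j$ produces $\mathcal Z(T_j)=[Z(T_j,1),\dots,Z(T_j,\nu(T_j))]$ with $Z(T_j,k)=\sum_{e'\in I(T_j)}\epsilon_{(e',(T_j,k))}Y(e')$. The coefficients $\alpha,\beta,\epsilon$ are in $\mathbb F_q$. Matrices. $F$ is the square matrix indexed by the ports with $F_{i,j}=1$ if $(e_i,e_j)\in\mathcal E$; $F_{i,j}=\beta_{(e_i,e_j)}$ if $e_i\in I(V)$ and $e_j\in O(V)$ for some node $V$; and $F_{i,j}=0$ otherwise. $A$ has rows indexed by the source processes and columns by the ports, with $A_{i,j}=\alpha_{(i,e_j)}$ if $e_j\in O(S)$ and $0$ otherwise. $B$ has rows indexed by the destination processes $(T_j,k)$ and columns by the ports, its entry in row $(T_j,k)$ and column $e_i$ being $\epsilon_{(e_i,(T_j,k))}$ if $e_i\in I(T_j)$ and $0$ otherwise. *)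

theory Defs
  imports Jordan_Normal_Form.Gauss_Jordan_Elimination
begin

record ('v, 'p) network =
  nodes :: "'v set"
  in_ports :: "'v \<Rightarrow> 'p set"
  out_ports :: "'v \<Rightarrow> 'p set"
  edges :: "('p \<times> 'p) set"

definition ports :: "('v, 'p) network \<Rightarrow> 'p set" where
  "ports G = (\<Union>V \<in> nodes G. in_ports G V \<union> out_ports G V)"

definition wf_network :: "('v, 'p) network \<Rightarrow> bool" where
  "wf_network G \<longleftrightarrow>
     finite (nodes G) \<and>
     (\<forall>V \<in> nodes G. finite (in_ports G V) \<and> finite (out_ports G V)) \<and>
     (\<forall>V \<in> nodes G. \<forall>W \<in> nodes G. in_ports G V \<inter> out_ports G W = {}) \<and>
     (\<forall>V \<in> nodes G. \<forall>W \<in> nodes G. V \<noteq> W \<longrightarrow>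
        in_ports G V \<inter> in_ports G W = {} \<and> out_ports G V \<inter> out_ports G W = {}) \<and>
     (\<forall>(e1, e2) \<in> edges G. \<exists>V1 \<in> nodes G. \<exists>V2 \<in> nodes G.
        e1 \<in> out_ports G V1 \<and> e2 \<in> in_ports G V2)"

definition node_arcs :: "('v, 'p) network \<Rightarrow> ('v \<times> 'v) set" where
  "node_arcs G = {(V1, V2). V1 \<in> nodes G \<and> V2 \<in> nodes G \<and>
     (\<exists>(e1, e2) \<in> edges G. e1 \<in> out_ports G V1 \<and> e2 \<in> in_ports G V2)}"

definition acyclic_network :: "('v, 'p) network \<Rightarrow> bool" where
  "acyclic_network G \<longleftrightarrow> acyclic (node_arcs G)"

text \<open>
  Processes are numbered from 0: the source processes are \<open>X 0, \<dots>, X (num_src C - 1)\<close>, and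
  destination \<open>T\<close> produces \<open>Z (T, 0), \<dots>, Z (T, num_dest C T - 1)\<close>. The coefficients
  \<open>alpha C i e\<close>, \<open>beta C e' e\<close> and \<open>epsilon C e' (T, k)\<close> are those at the index pairs
  \<open>(i, e)\<close>, \<open>(e', e)\<close> and \<open>(e', (T, k))\<close>; their values at other arguments play no role.
\<close>

record ('v, 'p, 'a) linear_code =
  source :: 'v
  num_src :: nat
  dests :: "'v list"
  num_dest :: "'v \<Rightarrow> nat"
  alpha :: "nat \<Rightarrow> 'p \<Rightarrow> 'a"
  beta :: "'p \<Rightarrow> 'p \<Rightarrow> 'a"
  epsilon :: "'p \<Rightarrow> 'v \<times> nat \<Rightarrow> 'a"

definition wf_linear_code :: "('v, 'p) network \<Rightarrow> ('v, 'p, 'a) linear_code \<Rightarrow> bool" where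
  "wf_linear_code G C \<longleftrightarrow> source C \<in> nodes G \<and> distinct (dests C) \<and> set (dests C) \<subseteq> nodes G"

text \<open>The order of the entries of the concatenated row vector of destination processes.\<close>

definition dest_procs :: "('v, 'p, 'a) linear_code \<Rightarrow> ('v \<times> nat) list" where
  "dest_procs C = concat (map (\<lambda>T. map (\<lambda>k. (T, k)) [0..<num_dest C T]) (dests C))"

definition transmission ::
  "('v, 'p) network \<Rightarrow> ('v, 'p, 'a :: comm_ring_1) linear_code \<Rightarrow>
     (nat \<Rightarrow> 'a) \<Rightarrow> ('p \<Rightarrow> 'a) \<Rightarrow> ('v \<times> nat \<Rightarrow> 'a) \<Rightarrow> bool" where
  "transmission G C X Y Z \<longleftrightarrow>
     (\<forall>V \<in> nodes G. V \<noteq> source C \<longrightarrow>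
        (\<forall>e \<in> out_ports G V. Y e = (\<Sum>e' \<in> in_ports G V. beta C e' e * Y e'))) \<and>
     (\<forall>e \<in> out_ports G (source C).
        Y e = (\<Sum>e' \<in> in_ports G (source C). beta C e' e * Y e')
            + (\<Sum>i < num_src C. alpha C i e * X i)) \<and>
     (\<forall>V \<in> nodes G. \<forall>e' \<in> in_ports G V. Y e' = (\<Sum>e \<in> {e. (e, e') \<in> edges G}. Y e)) \<and>
     (\<forall>T \<in> set (dests C). \<forall>k < num_dest C T.
        Z (T, k) = (\<Sum>e' \<in> in_ports G T. epsilon C e' (T, k) * Y e'))"

definition src_row :: "('v, 'p, 'a) linear_code \<Rightarrow> (nat \<Rightarrow> 'a) \<Rightarrow> 'a mat" where
  "src_row C X = mat 1 (num_src C) (\<lambda>(_, i). X i)"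

definition dest_row :: "('v, 'p, 'a) linear_code \<Rightarrow> ('v \<times> nat \<Rightarrow> 'a) \<Rightarrow> 'a mat" where
  "dest_row C Z = mat 1 (length (dest_procs C)) (\<lambda>(_, j). Z (dest_procs C ! j))"

definition is_system_matrix ::
  "('v, 'p) network \<Rightarrow> ('v, 'p, 'a :: comm_ring_1) linear_code \<Rightarrow> 'a mat \<Rightarrow> bool" where
  "is_system_matrix G C M \<longleftrightarrow>
     M \<in> carrier_mat (num_src C) (length (dest_procs C)) \<and>
     (\<forall>X Y Z. transmission G C X Y Z \<longrightarrow> dest_row C Z = src_row C X * M)"

text \<open>In the three matrices below, the list \<open>es\<close> is an enumeration of the ports.\<close>

definition adjacency_matrix ::
  "('v, 'p) network \<Rightarrow> ('v, 'p, 'a :: comm_ring_1) linear_code \<Rightarrow> 'p list \<Rightarrow> 'a mat" where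
  "adjacency_matrix G C es = mat (length es) (length es) (\<lambda>(i, j).
     if (es ! i, es ! j) \<in> edges G then 1
     else if \<exists>V \<in> nodes G. es ! i \<in> in_ports G V \<and> es ! j \<in> out_ports G V
       then beta C (es ! i) (es ! j)
     else 0)"

definition encoding_matrix ::
  "('v, 'p) network \<Rightarrow> ('v, 'p, 'a :: comm_ring_1) linear_code \<Rightarrow> 'p list \<Rightarrow> 'a mat" where
  "encoding_matrix G C es = mat (num_src C) (length es) (\<lambda>(i, j).
     if es ! j \<in> out_ports G (source C) then alpha C i (es ! j) else 0)"

definition decoding_matrix ::
  "('v, 'p) network \<Rightarrow> ('v, 'p, 'a :: comm_ring_1) linear_code \<Rightarrow> 'p list \<Rightarrow> 'a mat" where
  "decoding_matrix G C es = mat (length (dest_procs C)) (length es) (\<lambda>(r, i).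
     if es ! i \<in> in_ports G (fst (dest_procs C ! r))
       then epsilon C (es ! i) (dest_procs C ! r) else 0)"

end

theory Submission
  imports Defs Jordan_Normal_Form.Determinant
begin

text \<open>
  Collecting the symbols at all ports into a row vector \<open>y\<close>, the transmission equations say
  \<open>y = y F + x A\<close> and \<open>z = y B\<^sup>T\<close>. Along a chain of nonzero entries of \<open>F\<close> one moves from an
  input port to an output port of the same node or along an arc of the node graph, so acyclicity
  forces the kernel of \<open>I - F\<close> to be trivial. Hence every source vector \<open>x\<close> determines a unique
  \<open>y = x A (I - F)\<^sup>-\<^sup>1\<close>, and a matrix that acts like \<open>A (I - F)\<^sup>-\<^sup>1 B\<^sup>T\<close> on all \<open>x\<close> equals it.
\<close>

section \<open>Inverse matrices, distinct lists and affine fixed points\<close>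

text \<open>A nonzero determinant puts \<open>N\<close> among the units of the matrix ring, which
  rules out the result \<open>None\<close>. So \<open>the\<close> selects a genuine two-sided
  inverse and not an unspecified value.\<close>

lemma mat_inverse_inverts:
  fixes N :: "'a :: field mat"
  assumes N: "N \<in> carrier_mat n n" and det: "det N \<noteq> 0"
  defines "P \<equiv> the (mat_inverse N)"
  shows "P \<in> carrier_mat n n" "N * P = 1\<^sub>m n" "P * N = 1\<^sub>m n"
proof -
  have "N \<in> Units (ring_mat TYPE('a) n ())"
    by (rule det_non_zero_imp_unit[OF N det])
  then obtain Q where "mat_inverse N = Some Q"
    using mat_inverse(1)[OF N, of "()"] by (cases "mat_inverse N") auto
  then show "P \<in> carrier_mat n n" "N * P = 1\<^sub>m n" "P * N = 1\<^sub>m n"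
    using mat_inverse(2)[OF N, of Q] by (auto simp: P_def)
qed

lemma sum_nth_distinct:
  assumes "distinct xs"
  shows "(\<Sum>i<length xs. f (xs ! i)) = (\<Sum>x\<in>set xs. f x)"
  by (rule sum.reindex_bij_betw) (simp add: assms bij_betw_nth)

text \<open>In a distinct list each entry has exactly one position, so looking up that position and
  applying \<open>g\<close> is well defined. This turns a row matrix back into symbols at ports or
  at destination processes.\<close>

lemma exists_fun_of_list_values:
  assumes "distinct xs"
  shows "\<exists>f. \<forall>i<length xs. f (xs ! i) = g i"
proof -
  have inj: "inj_on ((!) xs) {..<length xs}"
    using assms by (simp add: inj_on_nth)
  have "\<forall>i<length xs. g (the_inv_into {..<length xs} ((!) xs) (xs ! i)) = g i"
    using the_inv_into_f_f[OF inj] by simp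
  then show ?thesis by (rule exI[of _ "\<lambda>x. g (the_inv_into {..<length xs} ((!) xs) x)"])
qed

text \<open>The fixed-point equation rearranges to \<open>y * (1\<^sub>m n - F) = b\<close>, which
  is then multiplied by \<open>P\<close> on the right. One direction uses \<open>NP\<close>, the
  other \<open>PN\<close>.\<close>

lemma row_affine_fixpoint_iff:
  fixes y :: "'a :: comm_ring_1 mat"
  assumes carr [simp]: "y \<in> carrier_mat m n" "b \<in> carrier_mat m n" "F \<in> carrier_mat n n"
    "P \<in> carrier_mat n n"
    and NP: "(1\<^sub>m n - F) * P = 1\<^sub>m n" and PN: "P * (1\<^sub>m n - F) = 1\<^sub>m n"
  shows "y = y * F + b \<longleftrightarrow> y = b * P"
proof -
  have dims: "dim_row y = m" "dim_col y = n" "dim_row b = m" "dim_col b = n"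
    "dim_row F = n" "dim_col F = n" "dim_row P = n" "dim_col P = n"
    using carr[THEN carrier_matD(1)] carr[THEN carrier_matD(2)] by auto
  have [simp]: "y * F \<in> carrier_mat m n" "1\<^sub>m n - F \<in> carrier_mat n n"
    by (auto simp: dims)
  have "y * (1\<^sub>m n - F) = y - y * F"
    by (simp add: mult_minus_distrib_mat[of y m n "1\<^sub>m n" n F] right_mult_one_mat[of y m n])
  moreover have "y = y * F + b \<longleftrightarrow> y - y * F = b"
    by (auto simp: mat_eq_iff dims algebra_simps)
  moreover have "y * (1\<^sub>m n - F) = b \<longleftrightarrow> y = b * P"
  proof
    assume "y * (1\<^sub>m n - F) = b"
    then have "b * P = y * ((1\<^sub>m n - F) * P)"
      using assoc_mult_mat[of y m n "1\<^sub>m n - F" n P n] by simp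
    then show "y = b * P" using right_mult_one_mat[of y m n] by (simp add: NP)
  next
    assume "y = b * P"
    then have "y * (1\<^sub>m n - F) = b * (P * (1\<^sub>m n - F))"
      using assoc_mult_mat[of b m n P n "1\<^sub>m n - F" n] by simp
    then show "y * (1\<^sub>m n - F) = b" using right_mult_one_mat[of b m n] by (simp add: PN)
  qed
  ultimately show ?thesis by simp
qed

section \<open>Row vectors of source, destination and port symbols\<close>

lemma src_row_carrier: "src_row C X \<in> carrier_mat 1 (num_src C)"
  by (simp add: src_row_def)

text \<open>Sending 1 on process \<open>i\<close> and 0 on all others reads off row \<open>i\<close>
  of \<open>M\<close>.\<close>

lemma src_row_mult_unit:
  fixes M :: "'a :: comm_ring_1 mat"
  assumes M: "M \<in> carrier_mat (num_src C) m" and i: "i < num_src C" and j: "j < m"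
  shows "(src_row C (\<lambda>k. if k = i then 1 else 0) * M) $$ (0, j) = M $$ (i, j)"
proof -
  have "(src_row C (\<lambda>k. if k = i then 1 else 0) * M) $$ (0, j)
      = (\<Sum>k<num_src C. (if k = i then 1 else 0) * M $$ (k, j))"
    using assms by (simp add: src_row_def scalar_prod_def lessThan_atLeast0)
  also have "\<dots> = (\<Sum>k<num_src C. if k = i then M $$ (k, j) else 0)"
    by (rule sum.cong) auto
  also have "\<dots> = M $$ (i, j)"
    using i by simp
  finally show ?thesis .
qed

text \<open>Unit vectors are among the admissible source vectors and expose every row. This gives
  the uniqueness of the system matrix.\<close>

lemma mat_eq_if_src_row_mult_eq:
  fixes M :: "'a :: comm_ring_1 mat"
  assumes "M \<in> carrier_mat (num_src C) m" "M' \<in> carrier_mat (num_src C) m"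
    and eq: "\<And>X. src_row C X * M = src_row C X * M'"
  shows "M = M'"
proof (rule eq_matI)
  fix i j assume "i < dim_row M'" "j < dim_col M'"
  then have "i < num_src C" "j < m"
    using assms(2) by auto
  then show "M $$ (i, j) = M' $$ (i, j)"
    using src_row_mult_unit[OF assms(1)] src_row_mult_unit[OF assms(2)] eq by metis
qed (use assms(1,2) in auto)

lemma set_dest_procs:
  "set (dest_procs C) = {(T, k). T \<in> set (dests C) \<and> k < num_dest C T}"
  by (auto simp: dest_procs_def)

text \<open>Pairs from different destinations differ in the first component, pairs from the same one
  in the second. Hence no two columns of a destination row impose conflicting values on
  \<open>Z\<close>.\<close>

lemma distinct_dest_procs:
  assumes "distinct (dests C)"
  shows "distinct (dest_procs C)"
proof -
  have "distinct (concat (map (\<lambda>T. map (\<lambda>k. (T, k)) [0..<num_dest C T]) Ts))"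
    if "distinct Ts" for Ts
    using that by (induction Ts) (auto simp: distinct_map inj_on_def)
  then show ?thesis using assms by (simp add: dest_procs_def)
qed

definition port_row :: "'p list \<Rightarrow> ('p \<Rightarrow> 'a) \<Rightarrow> 'a mat" where
  "port_row es Y = mat 1 (length es) (\<lambda>(_, j). Y (es ! j))"

lemma port_row_carrier: "port_row es Y \<in> carrier_mat 1 (length es)"
  by (simp add: port_row_def)

lemma exists_port_row:
  assumes "distinct es" and y: "y \<in> carrier_mat 1 (length es)"
  shows "\<exists>Y. port_row es Y = y"
proof -
  obtain Y where "\<forall>j<length es. Y (es ! j) = y $$ (0, j)"
    using exists_fun_of_list_values[OF assms(1), of "\<lambda>j. y $$ (0, j)"] by blast
  then have "port_row es Y = y"
    using y by (auto simp: port_row_def mat_eq_iff)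
  then show ?thesis by blast
qed

lemma exists_dest_row:
  assumes "distinct (dests C)" and z: "z \<in> carrier_mat 1 (length (dest_procs C))"
  shows "\<exists>Z. dest_row C Z = z"
proof -
  obtain Z where "\<forall>j<length (dest_procs C). Z (dest_procs C ! j) = z $$ (0, j)"
    using exists_fun_of_list_values[OF distinct_dest_procs[OF assms(1)], of "\<lambda>j. z $$ (0, j)"]
    by blast
  then have "dest_row C Z = z"
    using z by (auto simp: dest_row_def mat_eq_iff)
  then show ?thesis by blast
qed

section \<open>Ports of a coded network and columns of its adjacency matrix\<close>

locale coded_network =
  fixes G :: "('v, 'p) network"
    and C :: "('v, 'p, 'a :: field) linear_code"
    and es :: "'p list"
  assumes wf_net: "wf_network G"
    and wf_code: "wf_linear_code G C"
    and distinct_es: "distinct es" and set_es: "set es = ports G"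
begin

abbreviation "A \<equiv> encoding_matrix G C es"
abbreviation "B \<equiv> decoding_matrix G C es"
abbreviation "F \<equiv> adjacency_matrix G C es"

lemma carriers [simp]:
  "A \<in> carrier_mat (num_src C) (length es)"
  "B \<in> carrier_mat (length (dest_procs C)) (length es)"
  "F \<in> carrier_mat (length es) (length es)"
  by (auto simp: encoding_matrix_def decoding_matrix_def adjacency_matrix_def)

lemma in_out_disjoint:
  "V \<in> nodes G \<Longrightarrow> W \<in> nodes G \<Longrightarrow> e \<in> in_ports G V \<Longrightarrow> e \<notin> out_ports G W"
  using wf_net unfolding wf_network_def by blast

lemma in_ports_unique:
  "V \<in> nodes G \<Longrightarrow> W \<in> nodes G \<Longrightarrow> e \<in> in_ports G V \<Longrightarrow> e \<in> in_ports G W \<Longrightarrow> V = W"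
  using wf_net unfolding wf_network_def by blast

lemma out_ports_unique:
  "V \<in> nodes G \<Longrightarrow> W \<in> nodes G \<Longrightarrow> e \<in> out_ports G V \<Longrightarrow> e \<in> out_ports G W \<Longrightarrow> V = W"
  using wf_net unfolding wf_network_def by blast

lemma edgeE:
  assumes "(e1, e2) \<in> edges G"
  obtains V W where "V \<in> nodes G" "W \<in> nodes G" "e1 \<in> out_ports G V" "e2 \<in> in_ports G W"
  using assms wf_net unfolding wf_network_def by blast

lemma in_port_in_set: "V \<in> nodes G \<Longrightarrow> e \<in> in_ports G V \<Longrightarrow> e \<in> set es"
  and out_port_in_set: "V \<in> nodes G \<Longrightarrow> e \<in> out_ports G V \<Longrightarrow> e \<in> set es"
  by (auto simp: set_es ports_def)

lemma edge_in_set: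
  assumes "(e1, e2) \<in> edges G"
  shows "e1 \<in> set es"
  using assms out_port_in_set by (meson edgeE)

text \<open>Edges end at input ports, so none contributes to the column of an output port. Since
  that port belongs to one node only, the existential in the definition of \<open>F\<close> can be
  fixed to \<open>V\<close>.\<close>

lemma adjacency_out_col:
  assumes "V \<in> nodes G" "es ! j \<in> out_ports G V" "i < length es" "j < length es"
  shows "F $$ (i, j) = (if es ! i \<in> in_ports G V then beta C (es ! i) (es ! j) else 0)"
proof -
  have "(es ! i, es ! j) \<notin> edges G"
    using assms(1,2) in_out_disjoint by (meson edgeE)
  moreover have "(\<exists>W\<in>nodes G. es ! i \<in> in_ports G W \<and> es ! j \<in> out_ports G W) \<longleftrightarrow>
      es ! i \<in> in_ports G V"
    using assms(1,2) out_ports_unique by metis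
  ultimately show ?thesis
    using assms(3,4) by (simp add: adjacency_matrix_def)
qed

text \<open>An input port is an output port of no node, so the \<open>beta\<close> branch never
  applies in its column.\<close>

lemma adjacency_in_col:
  assumes "V \<in> nodes G" "es ! j \<in> in_ports G V" "i < length es" "j < length es"
  shows "F $$ (i, j) = (if (es ! i, es ! j) \<in> edges G then 1 else 0)"
proof -
  have "(\<exists>W\<in>nodes G. es ! i \<in> in_ports G W \<and> es ! j \<in> out_ports G W) = False"
    using assms(1,2) in_out_disjoint by metis
  with assms(3,4) show ?thesis
    unfolding adjacency_matrix_def by (simp only: index_mat prod.case if_False)
qed

section \<open>The transmission equations in matrix form\<close>

lemma port_row_mult_out:
  assumes V: "V \<in> nodes G" and e: "es ! j \<in> out_ports G V" and j: "j < length es"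
  shows "(port_row es Y * F) $$ (0, j) = (\<Sum>e'\<in>in_ports G V. beta C e' (es ! j) * Y e')"
proof -
  have "(port_row es Y * F) $$ (0, j) = (\<Sum>i<length es. Y (es ! i) * F $$ (i, j))"
    using j by (simp add: port_row_def scalar_prod_def lessThan_atLeast0 adjacency_matrix_def)
  \<comment> \<open>The summand is written as a function of the port \<open>es ! i\<close>, which
    lets \<open>sum_nth_distinct\<close> pass from positions to ports.\<close>
  also have "\<dots> = (\<Sum>i<length es. (\<lambda>e'. if e' \<in> in_ports G V then beta C e' (es ! j) * Y e' else 0) (es ! i))"
    using V e j by (intro sum.cong) (auto simp: adjacency_out_col)
  also have "\<dots> = (\<Sum>e'\<in>set es. if e' \<in> in_ports G V then beta C e' (es ! j) * Y e' else 0)"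
    by (rule sum_nth_distinct[OF distinct_es])
  also have "\<dots> = (\<Sum>e'\<in>in_ports G V. beta C e' (es ! j) * Y e')"
    using in_port_in_set[OF V] by (intro sum.mono_neutral_cong_right) auto
  finally show ?thesis .
qed

lemma port_row_mult_in:
  assumes V: "V \<in> nodes G" and e: "es ! j \<in> in_ports G V" and j: "j < length es"
  shows "(port_row es Y * F) $$ (0, j) = (\<Sum>e\<in>{e. (e, es ! j) \<in> edges G}. Y e)"
proof -
  have "(port_row es Y * F) $$ (0, j) = (\<Sum>i<length es. Y (es ! i) * F $$ (i, j))"
    using j by (simp add: port_row_def scalar_prod_def lessThan_atLeast0 adjacency_matrix_def)
  also have "\<dots> = (\<Sum>i<length es. (\<lambda>e. if (e, es ! j) \<in> edges G then Y e else 0) (es ! i))"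
    using V e j by (intro sum.cong) (auto simp: adjacency_in_col)
  also have "\<dots> = (\<Sum>e\<in>set es. if (e, es ! j) \<in> edges G then Y e else 0)"
    by (rule sum_nth_distinct[OF distinct_es])
  \<comment> \<open>Every edge starts at a listed port, so the predecessors form a subset of the
    finite set \<open>set es\<close> and only zero terms are dropped.\<close>
  also have "\<dots> = (\<Sum>e\<in>{e. (e, es ! j) \<in> edges G}. Y e)"
    using edge_in_set by (intro sum.mono_neutral_cong_right) auto
  finally show ?thesis .
qed

lemma src_row_mult:
  assumes "j < length es"
  shows "(src_row C X * A) $$ (0, j) =
    (if es ! j \<in> out_ports G (source C) then \<Sum>i<num_src C. alpha C i (es ! j) * X i else 0)"
  using assms
  by (auto simp: src_row_def encoding_matrix_def scalar_prod_def lessThan_atLeast0 mult.commute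
      intro!: sum.cong)

lemma port_row_mult_decoding:
  assumes r: "r < length (dest_procs C)" and Tk: "dest_procs C ! r = (T, k)"
  shows "(port_row es Y * transpose_mat B) $$ (0, r) = (\<Sum>e'\<in>in_ports G T. epsilon C e' (T, k) * Y e')"
proof -
  have "(T, k) \<in> set (dest_procs C)"
    using r Tk nth_mem by metis
  then have T: "T \<in> nodes G"
    using wf_code by (auto simp: set_dest_procs wf_linear_code_def)
  have "(port_row es Y * transpose_mat B) $$ (0, r) = (\<Sum>i<length es. Y (es ! i) * B $$ (r, i))"
    using r by (simp add: port_row_def scalar_prod_def lessThan_atLeast0 decoding_matrix_def)
  also have "\<dots> = (\<Sum>i<length es.
      (\<lambda>e'. if e' \<in> in_ports G T then epsilon C e' (T, k) * Y e' else 0) (es ! i))"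
    using r Tk by (intro sum.cong) (auto simp: decoding_matrix_def)
  also have "\<dots> = (\<Sum>e'\<in>set es. if e' \<in> in_ports G T then epsilon C e' (T, k) * Y e' else 0)"
    by (rule sum_nth_distinct[OF distinct_es])
  also have "\<dots> = (\<Sum>e'\<in>in_ports G T. epsilon C e' (T, k) * Y e')"
    using in_port_in_set[OF T] by (intro sum.mono_neutral_cong_right) auto
  finally show ?thesis .
qed

lemma dest_row_eq_iff:
  "dest_row C Z = port_row es Y * transpose_mat B \<longleftrightarrow>
     (\<forall>T \<in> set (dests C). \<forall>k < num_dest C T.
        Z (T, k) = (\<Sum>e' \<in> in_ports G T. epsilon C e' (T, k) * Y e'))"
    (is "?L \<longleftrightarrow> ?R")
proof -
  let ?f = "\<lambda>(T, k). \<Sum>e' \<in> in_ports G T. epsilon C e' (T, k) * Y e'"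
  have f: "(port_row es Y * transpose_mat B) $$ (0, r) = ?f (dest_procs C ! r)"
    if "r < length (dest_procs C)" for r
    using port_row_mult_decoding[OF that] by (cases "dest_procs C ! r") auto
  have "?L \<longleftrightarrow> (\<forall>r<length (dest_procs C). dest_row C Z $$ (0, r) = (port_row es Y * transpose_mat B) $$ (0, r))"
    by (auto simp: mat_eq_iff dest_row_def port_row_def decoding_matrix_def)
  also have "\<dots> \<longleftrightarrow> (\<forall>r<length (dest_procs C). Z (dest_procs C ! r) = ?f (dest_procs C ! r))"
    using f by (simp add: dest_row_def)
  also have "\<dots> \<longleftrightarrow> (\<forall>p \<in> set (dest_procs C). Z p = ?f p)"
    by (simp add: all_set_conv_all_nth)
  also have "\<dots> \<longleftrightarrow> ?R"
    by (auto simp: set_dest_procs)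
  finally show ?thesis .
qed

text \<open>Column \<open>j\<close> of the matrix equation is the equation at port
  \<open>es ! j\<close>. The three conjuncts correspond to outputs of other nodes, outputs of the
  source, and inputs; the summand from \<open>A\<close> survives only in the second kind.\<close>

lemma port_equations_iff:
  "port_row es Y = port_row es Y * F + src_row C X * A \<longleftrightarrow>
     (\<forall>V \<in> nodes G. V \<noteq> source C \<longrightarrow>
        (\<forall>e \<in> out_ports G V. Y e = (\<Sum>e' \<in> in_ports G V. beta C e' e * Y e'))) \<and>
     (\<forall>e \<in> out_ports G (source C).
        Y e = (\<Sum>e' \<in> in_ports G (source C). beta C e' e * Y e')
            + (\<Sum>i < num_src C. alpha C i e * X i)) \<and>
     (\<forall>V \<in> nodes G. \<forall>e' \<in> in_ports G V. Y e' = (\<Sum>e \<in> {e. (e, e') \<in> edges G}. Y e))"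
    (is "?L \<longleftrightarrow> ?R")
proof -
  let ?rhs = "\<lambda>j. (port_row es Y * F) $$ (0, j) + (src_row C X * A) $$ (0, j)"
  have S: "source C \<in> nodes G"
    using wf_code by (simp add: wf_linear_code_def)
  \<comment> \<open>An output port of \<open>V\<close> is not one of the source, so the contribution
    of \<open>A\<close> vanishes here.\<close>
  have other: "?rhs j = (\<Sum>e'\<in>in_ports G V. beta C e' (es ! j) * Y e')"
    if "V \<in> nodes G" "V \<noteq> source C" "es ! j \<in> out_ports G V" "j < length es" for V j
    using that out_ports_unique[OF _ S] by (auto simp: port_row_mult_out src_row_mult)
  have src: "?rhs j = (\<Sum>e'\<in>in_ports G (source C). beta C e' (es ! j) * Y e')
      + (\<Sum>i<num_src C. alpha C i (es ! j) * X i)"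
    if "es ! j \<in> out_ports G (source C)" "j < length es" for j
    using that S by (simp add: port_row_mult_out src_row_mult)
  have inp: "?rhs j = (\<Sum>e\<in>{e. (e, es ! j) \<in> edges G}. Y e)"
    if "V \<in> nodes G" "es ! j \<in> in_ports G V" "j < length es" for V j
    using that in_out_disjoint[OF _ S] by (auto simp: port_row_mult_in src_row_mult)
  have nth: "\<exists>j<length es. e = es ! j" if "V \<in> nodes G" "e \<in> in_ports G V \<union> out_ports G V" for V e
    using that in_port_in_set out_port_in_set by (metis Un_iff in_set_conv_nth)
  have L: "?L \<longleftrightarrow> (\<forall>j<length es. Y (es ! j) = ?rhs j)"
    by (auto simp: mat_eq_iff port_row_def src_row_def encoding_matrix_def adjacency_matrix_def)
  show ?thesis
  proof
    assume ?L
    then have eq: "\<And>j. j < length es \<Longrightarrow> Y (es ! j) = ?rhs j"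
      using L by blast
    show ?R
    proof (intro conjI ballI impI)
      fix V e assume "V \<in> nodes G" "V \<noteq> source C" "e \<in> out_ports G V"
      then show "Y e = (\<Sum>e' \<in> in_ports G V. beta C e' e * Y e')"
        using nth[of V e] eq other[of V] by auto
    next
      fix e assume "e \<in> out_ports G (source C)"
      then show "Y e = (\<Sum>e' \<in> in_ports G (source C). beta C e' e * Y e')
            + (\<Sum>i < num_src C. alpha C i e * X i)"
        using nth[OF S, of e] eq src by auto
    next
      fix V e assume "V \<in> nodes G" "e \<in> in_ports G V"
      then show "Y e = (\<Sum>e' \<in> {e'. (e', e) \<in> edges G}. Y e')"
        using nth[of V e] eq inp[of V] by auto
    qed
  next
    assume R: ?R
    have "Y (es ! j) = ?rhs j" if j: "j < length es" for j
    proof -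
      have "es ! j \<in> ports G"
        using j set_es nth_mem by blast
      then obtain V where "V \<in> nodes G" "es ! j \<in> in_ports G V \<or> es ! j \<in> out_ports G V"
        by (auto simp: ports_def)
      then consider "es ! j \<in> in_ports G V" | "V \<noteq> source C" "es ! j \<in> out_ports G V"
        | "es ! j \<in> out_ports G (source C)"
        by blast
      then show ?thesis
        by cases (use R j \<open>V \<in> nodes G\<close> other[of V j] src[of j] inp[of V j] in simp_all)
    qed
    then show ?L using L by blast
  qed
qed

lemma transmission_iff:
  "transmission G C X Y Z \<longleftrightarrow>
     port_row es Y = port_row es Y * F + src_row C X * A \<and> dest_row C Z = port_row es Y * transpose_mat B"
  unfolding transmission_def port_equations_iff dest_row_eq_iff by blast

section \<open>Invertibility of I - F\<close>

text \<open>For a column vector \<open>v\<close> the kernel equation expresses each entry through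
  those at ports directly following it. The induction therefore runs against the arcs: a node is
  handled after all nodes that its arcs reach, beginning with the sinks.\<close>

lemma adjacency_kernel_trivial:
  assumes acyc: "acyclic_network G"
    and v: "v \<in> carrier_vec (length es)" and Nv: "(1\<^sub>m (length es) - F) *\<^sub>v v = 0\<^sub>v (length es)"
  shows "v = 0\<^sub>v (length es)"
proof -
  have step: "v $ i = (\<Sum>j<length es. F $$ (i, j) * v $ j)" if i: "i < length es" for i
  proof -
    have "0 = ((1\<^sub>m (length es) - F) *\<^sub>v v) $ i"
      using i Nv by simp
    also have "\<dots> = (\<Sum>j<length es. ((if i = j then 1 else 0) - F $$ (i, j)) * v $ j)"
      using i v by (auto simp: scalar_prod_def lessThan_atLeast0 adjacency_matrix_def intro!: sum.cong)
    also have "\<dots> = (\<Sum>j<length es. if i = j then v $ j else 0) - (\<Sum>j<length es. F $$ (i, j) * v $ j)"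
      by (subst sum_subtractf[symmetric], rule sum.cong) (auto simp: algebra_simps)
    also have "(\<Sum>j<length es. if i = j then v $ j else 0) = v $ i"
      using i by simp
    finally show ?thesis by simp
  qed
  \<comment> \<open>Finiteness turns acyclicity into well-foundedness of the converse
    relation.\<close>
  have "finite (nodes G)"
    using wf_net by (simp add: wf_network_def)
  then have "finite (node_arcs G)"
    by (intro finite_subset[of "node_arcs G" "nodes G \<times> nodes G"]) (auto simp: node_arcs_def)
  then have "wf ((node_arcs G)\<inverse>)"
    using acyc by (simp add: acyclic_network_def finite_acyclic_wf_converse)
  then have zero: "V \<in> nodes G \<Longrightarrow> i < length es \<Longrightarrow> es ! i \<in> in_ports G V \<union> out_ports G V \<Longrightarrow> v $ i = 0"
    for V i
  proof (induction V arbitrary: i rule: wf_induct_rule)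
    case (less V)
    \<comment> \<open>Output ports come first: a nonzero entry in such a row belongs to an edge into
      a node \<open>W\<close> with an arc from \<open>V\<close>, where the induction hypothesis
      applies.\<close>
    have out: "v $ i = 0" if i: "i < length es" and e: "es ! i \<in> out_ports G V" for i
    proof -
      have "F $$ (i, j) * v $ j = 0" if j: "j < length es" for j
      proof (cases "(es ! i, es ! j) \<in> edges G")
        case True
        then obtain W where W: "W \<in> nodes G" "es ! j \<in> in_ports G W"
          by (elim edgeE)
        then have "(V, W) \<in> node_arcs G"
          using less.prems(1) e True by (auto simp: node_arcs_def)
        then show ?thesis
          using less.IH[of W j] W j by simp
      next
        case False
        then show ?thesis
          using i j e less.prems(1) in_out_disjoint by (auto simp: adjacency_matrix_def)
      qed
      then show ?thesis
        using step[OF i] by (simp del: mult_eq_0_iff)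
    qed
    \<comment> \<open>From an input port, nonzero entries lead only to output ports of the same
      node. No arc is followed, so the fact \<open>out\<close> takes the place of the induction
      hypothesis.\<close>
    have inp: "v $ i = 0" if i: "i < length es" and e: "es ! i \<in> in_ports G V" for i
    proof -
      have "F $$ (i, j) * v $ j = 0" if j: "j < length es" for j
      proof (cases "F $$ (i, j) = 0")
        case False
        moreover have "(es ! i, es ! j) \<notin> edges G"
          using e less.prems(1) in_out_disjoint by (meson edgeE)
        ultimately have "es ! j \<in> out_ports G V"
          using i j e less.prems(1) in_ports_unique
          by (auto simp: adjacency_matrix_def split: if_splits)
        then show ?thesis
          using out[OF j] by simp
      qed simp
      then show ?thesis
        using step[OF i] by (simp del: mult_eq_0_iff)
    qed
    show ?case
      using less.prems out inp by blast
  qed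
  show ?thesis
  proof (rule eq_vecI)
    fix i assume "i < dim_vec (0\<^sub>v (length es) :: 'a vec)"
    then have i: "i < length es" by simp
    then have "es ! i \<in> ports G"
      using set_es nth_mem by blast
    then show "v $ i = 0\<^sub>v (length es) $ i"
      using zero i by (auto simp: ports_def)
  qed (use v in simp)
qed

text \<open>Over a field, a vanishing determinant would yield a nonzero kernel vector.\<close>

lemma det_one_minus_adjacency:
  assumes "acyclic_network G"
  shows "det (1\<^sub>m (length es) - F) \<noteq> 0"
  using adjacency_kernel_trivial[OF assms] det_0_iff_vec_prod_zero_field[of "1\<^sub>m (length es) - F" "length es"]
  by (auto simp: minus_carrier_mat)

section \<open>Existence and uniqueness of the system matrix\<close>

text \<open>Solving the port equations for \<open>Y\<close> shows that the formula gives a system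
  matrix. Conversely, any system matrix agrees with it on every source vector, because each source
  vector occurs in some transmission.\<close>

lemma is_system_matrix_iff:
  assumes acyc: "acyclic_network G"
  shows "is_system_matrix G C M \<longleftrightarrow> M = A * the (mat_inverse (1\<^sub>m (length es) - F)) * transpose_mat B"
proof -
  let ?n = "length es" and ?m = "length (dest_procs C)"
  define P where "P = the (mat_inverse (1\<^sub>m ?n - F))"
  have "1\<^sub>m ?n - F \<in> carrier_mat ?n ?n"
    by (simp add: minus_carrier_mat)
  note inv = mat_inverse_inverts[OF this det_one_minus_adjacency[OF acyc], folded P_def]
  note P = inv(1)
  have xA: "src_row C X * A \<in> carrier_mat 1 ?n" for X
    by (rule mult_carrier_mat[OF src_row_carrier carriers(1)])
  have AP: "A * P \<in> carrier_mat (num_src C) ?n"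
    by (rule mult_carrier_mat[OF carriers(1) P])
  have xAP: "src_row C X * A * P \<in> carrier_mat 1 ?n" for X
    by (rule mult_carrier_mat[OF xA P])
  have BT: "transpose_mat B \<in> carrier_mat ?n ?m" by simp
  have M0: "A * P * transpose_mat B \<in> carrier_mat (num_src C) ?m"
    by (rule mult_carrier_mat[OF AP BT])
  have tr: "transmission G C X Y Z \<longleftrightarrow>
      port_row es Y = src_row C X * A * P \<and> dest_row C Z = port_row es Y * transpose_mat B" for X Y Z
    unfolding transmission_iff
    using row_affine_fixpoint_iff[OF port_row_carrier xA carriers(3) P inv(2,3)] by blast
  have assoc: "src_row C X * A * P * transpose_mat B = src_row C X * (A * P * transpose_mat B)" for X
    using assoc_mult_mat[OF src_row_carrier carriers(1) P, of X]
      assoc_mult_mat[OF src_row_carrier AP BT, of X] by simp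
  \<comment> \<open>Without a transmission for each \<open>X\<close>, the condition in
    \<open>is_system_matrix\<close> could hold vacuously and would not determine \<open>M\<close>.
    The witness \<open>Y\<close> is read off the solved row, and \<open>Z\<close> is then decoded
    from it.\<close>
  have ex: "\<exists>Y Z. transmission G C X Y Z" for X
  proof -
    obtain Y where Y: "port_row es Y = src_row C X * A * P"
      using exists_port_row[OF distinct_es xAP] by blast
    have "port_row es Y * transpose_mat B \<in> carrier_mat 1 ?m"
      by (rule mult_carrier_mat[OF port_row_carrier BT])
    then obtain Z where "dest_row C Z = port_row es Y * transpose_mat B"
      using exists_dest_row wf_code unfolding wf_linear_code_def by blast
    with Y show ?thesis unfolding tr by blast
  qed
  have out: "dest_row C Z = src_row C X * (A * P * transpose_mat B)" if "transmission G C X Y Z" for X Y Z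
    using that assoc unfolding tr by simp
  have "is_system_matrix G C M \<longleftrightarrow> M = A * P * transpose_mat B"
  proof
    assume "is_system_matrix G C M"
    then have M: "M \<in> carrier_mat (num_src C) ?m"
      and sys: "\<And>X Y Z. transmission G C X Y Z \<Longrightarrow> dest_row C Z = src_row C X * M"
      by (auto simp: is_system_matrix_def)
    have "src_row C X * M = src_row C X * (A * P * transpose_mat B)" for X
      using ex[of X] sys out by metis
    then show "M = A * P * transpose_mat B"
      by (rule mat_eq_if_src_row_mult_eq[OF M M0])
  next
    assume "M = A * P * transpose_mat B"
    then show "is_system_matrix G C M"
      using M0 out unfolding is_system_matrix_def by blast
  qed
  then show ?thesis by (simp add: P_def)
qed

lemma invertible_one_minus_adjacency:
  assumes "acyclic_network G"
  shows "invertible_mat (1\<^sub>m (length es) - F)"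
proof -
  have N: "1\<^sub>m (length es) - F \<in> carrier_mat (length es) (length es)"
    by (simp add: minus_carrier_mat)
  note inv = mat_inverse_inverts[OF N det_one_minus_adjacency[OF assms]]
  show ?thesis
    unfolding invertible_mat_def inverts_mat_def
    using N inv by (metis carrier_matD square_mat.simps)
qed

end

text \<open>The first conjunct ensures that \<open>the (mat_inverse ...)\<close> denotes an actual
  inverse. The equivalence for all \<open>M\<close> contains both existence and uniqueness, and the
  arbitrary enumeration \<open>es\<close> makes the formula valid for every ordering of the
  ports.\<close>

theorem theorem1:
  fixes G :: "('v, 'p) network"
    and C :: "('v, 'p, 'a :: {field, finite}) linear_code"
    and es :: "'p list"
    and A B F :: "'a mat"
  assumes "wf_network G"
    and "acyclic_network G"
    and "wf_linear_code G C"
    and "distinct es" and "set es = ports G"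
    and "A = encoding_matrix G C es"
    and "B = decoding_matrix G C es"
    and "F = adjacency_matrix G C es"
  shows "invertible_mat (1\<^sub>m (length es) - F) \<and>
    (\<forall>M. is_system_matrix G C M \<longleftrightarrow>
         M = A * the (mat_inverse (1\<^sub>m (length es) - F)) * transpose_mat B)"
proof -
  interpret coded_network G C es
    using assms by unfold_locales
  show ?thesis
    using invertible_one_minus_adjacency is_system_matrix_iff assms by simp
qed

end
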